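(* Let $G=G_1\ast_Q G_2$ be the amalgamated product of groups $G_1$ and $G_2$ over a common subgroup $Q$. If $Q$ is quasi-normal in $G_i$ for each $i\in\{1,2\}$, then $Q$ is quasi-normal in $G$.
   Context: For a subgroup $H$ of a group $G$, the commensurator of $H$ in $G$ is $Comm(H,G)=\{g\in G : gHg^{-1}\cap H \text{ has finite index in both } H \text{ and } gHg^{-1}\}$. A subgroup $Q$ of $G$ is quasi-normal in $G$ if $Comm(Q,G)=G$. *)

theory Defs
  imports "HOL-Algebra.Algebra"
begin

definition finite_index :: "('a, 'm) monoid_scheme \<Rightarrow> 'a set \<Rightarrow> 'a set \<Rightarrow> bool"
  where "finite_index G H K \<longleftrightarrow> finite (rcosets\<^bsub>G\<lparr>carrier := H\<rparr>\<^esub> K)"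
  \<comment> \<open>\<open>K\<close> has finite index in \<open>H\<close>, where \<open>K \<subseteq> H\<close> are subgroups of \<open>G\<close>\<close>

definition conjugate :: "('a, 'm) monoid_scheme \<Rightarrow> 'a \<Rightarrow> 'a set \<Rightarrow> 'a set"
  where "conjugate G g H = (g <#\<^bsub>G\<^esub> H) #>\<^bsub>G\<^esub> (inv\<^bsub>G\<^esub> g)"

definition Comm :: "'a set \<Rightarrow> ('a, 'm) monoid_scheme \<Rightarrow> 'a set"
  where "Comm H G = {g \<in> carrier G.
    finite_index G H (conjugate G g H \<inter> H) \<and>
    finite_index G (conjugate G g H) (conjugate G g H \<inter> H)}"

definition quasi_normal :: "'a set \<Rightarrow> ('a, 'm) monoid_scheme \<Rightarrow> bool"
  where "quasi_normal Q G \<longleftrightarrow> subgroup Q G \<and> Comm Q G = carrier G"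

text \<open>
  The amalgamated product of \<open>G1\<close> and \<open>G2\<close> over a common subgroup \<open>Q\<close>, given with its embeddings
  \<open>i1 : Q \<rightarrow> G1\<close> and \<open>i2 : Q \<rightarrow> G2\<close>: words in the disjoint union of \<open>G1\<close> and \<open>G2\<close>, modulo the
  monoid congruence generated by the multiplication tables of \<open>G1\<close> and \<open>G2\<close> and by the
  identification of \<open>i1 q\<close> with \<open>i2 q\<close> for all \<open>q\<close> in \<open>Q\<close>.
\<close>

inductive_set amalg_rel ::
  "('a, 'm) monoid_scheme \<Rightarrow> ('b, 'n) monoid_scheme \<Rightarrow> ('q, 'k) monoid_scheme \<Rightarrow>
    ('q \<Rightarrow> 'a) \<Rightarrow> ('q \<Rightarrow> 'b) \<Rightarrow> (('a + 'b) list \<times> ('a + 'b) list) set"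
  for G1 G2 Q i1 i2
  where
    refl: "w \<in> lists (carrier G1 <+> carrier G2) \<Longrightarrow> (w, w) \<in> amalg_rel G1 G2 Q i1 i2"
  | sym: "(u, v) \<in> amalg_rel G1 G2 Q i1 i2 \<Longrightarrow> (v, u) \<in> amalg_rel G1 G2 Q i1 i2"
  | trans: "(u, v) \<in> amalg_rel G1 G2 Q i1 i2 \<Longrightarrow> (v, w) \<in> amalg_rel G1 G2 Q i1 i2 \<Longrightarrow>
      (u, w) \<in> amalg_rel G1 G2 Q i1 i2"
  | append: "(u, v) \<in> amalg_rel G1 G2 Q i1 i2 \<Longrightarrow> (u', v') \<in> amalg_rel G1 G2 Q i1 i2 \<Longrightarrow>
      (u @ u', v @ v') \<in> amalg_rel G1 G2 Q i1 i2"
  | one1: "([Inl \<one>\<^bsub>G1\<^esub>], []) \<in> amalg_rel G1 G2 Q i1 i2"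
  | one2: "([Inr \<one>\<^bsub>G2\<^esub>], []) \<in> amalg_rel G1 G2 Q i1 i2"
  | mult1: "x \<in> carrier G1 \<Longrightarrow> y \<in> carrier G1 \<Longrightarrow>
      ([Inl x, Inl y], [Inl (x \<otimes>\<^bsub>G1\<^esub> y)]) \<in> amalg_rel G1 G2 Q i1 i2"
  | mult2: "x \<in> carrier G2 \<Longrightarrow> y \<in> carrier G2 \<Longrightarrow>
      ([Inr x, Inr y], [Inr (x \<otimes>\<^bsub>G2\<^esub> y)]) \<in> amalg_rel G1 G2 Q i1 i2"
  | amalg: "q \<in> carrier Q \<Longrightarrow> ([Inl (i1 q)], [Inr (i2 q)]) \<in> amalg_rel G1 G2 Q i1 i2"

definition amalg ::
  "('a, 'm) monoid_scheme \<Rightarrow> ('b, 'n) monoid_scheme \<Rightarrow> ('q, 'k) monoid_scheme \<Rightarrow>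
    ('q \<Rightarrow> 'a) \<Rightarrow> ('q \<Rightarrow> 'b) \<Rightarrow> ('a + 'b) list set monoid"
  where "amalg G1 G2 Q i1 i2 =
    \<lparr>carrier = lists (carrier G1 <+> carrier G2) // amalg_rel G1 G2 Q i1 i2,
     monoid.mult = (\<lambda>A B. amalg_rel G1 G2 Q i1 i2 `` {u @ v | u v. u \<in> A \<and> v \<in> B}),
     one = amalg_rel G1 G2 Q i1 i2 `` {[]}\<rparr>"

definition amalg_in1 ::
  "('a, 'm) monoid_scheme \<Rightarrow> ('b, 'n) monoid_scheme \<Rightarrow> ('q, 'k) monoid_scheme \<Rightarrow>
    ('q \<Rightarrow> 'a) \<Rightarrow> ('q \<Rightarrow> 'b) \<Rightarrow> 'a \<Rightarrow> ('a + 'b) list set"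
  where "amalg_in1 G1 G2 Q i1 i2 x = amalg_rel G1 G2 Q i1 i2 `` {[Inl x]}"

definition amalg_in2 ::
  "('a, 'm) monoid_scheme \<Rightarrow> ('b, 'n) monoid_scheme \<Rightarrow> ('q, 'k) monoid_scheme \<Rightarrow>
    ('q \<Rightarrow> 'a) \<Rightarrow> ('q \<Rightarrow> 'b) \<Rightarrow> 'b \<Rightarrow> ('a + 'b) list set"
  where "amalg_in2 G1 G2 Q i1 i2 y = amalg_rel G1 G2 Q i1 i2 `` {[Inr y]}"

text \<open>
  The remaining facts confirm that \<open>amalg\<close> is the pushout of groups along \<open>i1\<close> and \<open>i2\<close>.
\<close>

locale amalgamation =
  G1: group G1 + G2: group G2 + Q: group Q
  for G1 :: "('a, 'm) monoid_scheme" and G2 :: "('b, 'n) monoid_scheme"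
    and Q :: "('q, 'k) monoid_scheme" +
  fixes i1 :: "'q \<Rightarrow> 'a" and i2 :: "'q \<Rightarrow> 'b"
  assumes i1: "i1 \<in> mon Q G1" and i2: "i2 \<in> mon Q G2"
begin

abbreviation "W \<equiv> lists (carrier G1 <+> carrier G2)"
abbreviation "R \<equiv> amalg_rel G1 G2 Q i1 i2"
abbreviation "P \<equiv> amalg G1 G2 Q i1 i2"
abbreviation "in1 \<equiv> amalg_in1 G1 G2 Q i1 i2"
abbreviation "in2 \<equiv> amalg_in2 G1 G2 Q i1 i2"

lemma embedding_closed:
  assumes "q \<in> carrier Q"
  shows "i1 q \<in> carrier G1" "i2 q \<in> carrier G2"
  using assms i1 i2 by (auto simp: mon_def hom_def)

lemma rel_words: "(u, v) \<in> R \<Longrightarrow> u \<in> W \<and> v \<in> W"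
  by (induction rule: amalg_rel.induct) (auto simp: embedding_closed)

lemma equiv_rel: "equiv W R"
  by (rule equivI)
    (auto intro!: refl_onI symI transI dest: rel_words
      intro: amalg_rel.refl amalg_rel.sym amalg_rel.trans)

lemma class_mult:
  assumes "u \<in> W" "v \<in> W"
  shows "R `` {u} \<otimes>\<^bsub>P\<^esub> R `` {v} = R `` {u @ v}"
proof -
  have "R `` {u' @ v' | u' v'. u' \<in> R `` {u} \<and> v' \<in> R `` {v}} = R `` {u @ v}" (is "?L = _")
  proof
    show "?L \<subseteq> R `` {u @ v}"
      by (auto intro: amalg_rel.trans[OF amalg_rel.append])
    show "R `` {u @ v} \<subseteq> ?L"
      using assms by (auto simp: Image_def intro: amalg_rel.refl)
  qed
  then show ?thesis
    by (simp add: amalg_def)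
qed

lemma carrier_amalgE:
  assumes "A \<in> carrier P"
  obtains u where "u \<in> W" "A = R `` {u}"
  using assms unfolding amalg_def by (auto elim!: quotientE)

lemma class_closed: "u \<in> W \<Longrightarrow> R `` {u} \<in> carrier P"
  by (simp add: amalg_def quotientI)

lemma one_amalg: "\<one>\<^bsub>P\<^esub> = R `` {[]}"
  by (simp add: amalg_def)

lemma class_eq: "(u, v) \<in> R \<Longrightarrow> R `` {u} = R `` {v}"
  by (rule equiv_class_eq[OF equiv_rel])

lemma word_left_inverse:
  assumes "u \<in> W"
  shows "\<exists>v\<in>W. (v @ u, []) \<in> R"
  using assms
proof (induction u)
  case Nil
  show ?case by (rule bexI[of _ "[]"]) (auto intro: amalg_rel.refl)
next
  case (Cons a u)
  then obtain v where v: "v \<in> W" "(v @ u, []) \<in> R" and u: "u \<in> W" by auto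
  have "\<exists>b\<in>carrier G1 <+> carrier G2. ([b, a], []) \<in> R"
  proof (cases a)
    case (Inl x)
    then have "x \<in> carrier G1" using Cons by auto
    then have "([Inl (inv\<^bsub>G1\<^esub> x), Inl x], []) \<in> R"
      by (metis G1.inv_closed G1.l_inv amalg_rel.mult1 amalg_rel.one1 amalg_rel.trans)
    then show ?thesis using Inl \<open>x \<in> carrier G1\<close> by (intro bexI[of _ "Inl (inv\<^bsub>G1\<^esub> x)"]) auto
  next
    case (Inr x)
    then have "x \<in> carrier G2" using Cons by auto
    then have "([Inr (inv\<^bsub>G2\<^esub> x), Inr x], []) \<in> R"
      by (metis G2.inv_closed G2.l_inv amalg_rel.mult2 amalg_rel.one2 amalg_rel.trans)
    then show ?thesis using Inr \<open>x \<in> carrier G2\<close> by (intro bexI[of _ "Inr (inv\<^bsub>G2\<^esub> x)"]) auto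
  qed
  then obtain b where b: "b \<in> carrier G1 <+> carrier G2" "([b, a], []) \<in> R" by blast
  have "(v @ ([b, a] @ u), v @ ([] @ u)) \<in> R"
    using b u v by (intro amalg_rel.append amalg_rel.refl) auto
  then have "((v @ [b]) @ a # u, []) \<in> R"
    using v by (auto intro: amalg_rel.trans)
  then show ?case using v b by (intro bexI[of _ "v @ [b]"]) auto
qed

lemma group_amalg: "group P"
proof (rule groupI)
  show "\<one>\<^bsub>P\<^esub> \<in> carrier P" by (simp add: one_amalg class_closed)
next
  fix A B assume "A \<in> carrier P" "B \<in> carrier P"
  then show "A \<otimes>\<^bsub>P\<^esub> B \<in> carrier P"
    by (elim carrier_amalgE) (simp add: class_mult class_closed)
next
  fix A B C assume "A \<in> carrier P" "B \<in> carrier P" "C \<in> carrier P"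
  then show "A \<otimes>\<^bsub>P\<^esub> B \<otimes>\<^bsub>P\<^esub> C = A \<otimes>\<^bsub>P\<^esub> (B \<otimes>\<^bsub>P\<^esub> C)"
    by (elim carrier_amalgE) (simp add: class_mult)
next
  fix A assume "A \<in> carrier P"
  then show "\<one>\<^bsub>P\<^esub> \<otimes>\<^bsub>P\<^esub> A = A"
    by (elim carrier_amalgE) (simp add: class_mult one_amalg)
next
  fix A assume "A \<in> carrier P"
  then obtain u where u: "u \<in> W" "A = R `` {u}" by (rule carrier_amalgE)
  then obtain v where "v \<in> W" "(v @ u, []) \<in> R" using word_left_inverse by blast
  then show "\<exists>B\<in>carrier P. B \<otimes>\<^bsub>P\<^esub> A = \<one>\<^bsub>P\<^esub>"
    using u by (intro bexI[of _ "R `` {v}"]) (simp_all add: class_mult one_amalg class_eq class_closed)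
qed

lemma in1_hom: "in1 \<in> hom G1 P"
proof (rule homI)
  fix x y assume xy: "x \<in> carrier G1" "y \<in> carrier G1"
  then have "in1 x \<otimes>\<^bsub>P\<^esub> in1 y = R `` {[Inl x, Inl y]}"
    using class_mult[of "[Inl x]" "[Inl y]"] by (simp add: amalg_in1_def InlI)
  also have "\<dots> = in1 (x \<otimes>\<^bsub>G1\<^esub> y)"
    unfolding amalg_in1_def using xy by (intro class_eq amalg_rel.mult1)
  finally show "in1 (x \<otimes>\<^bsub>G1\<^esub> y) = in1 x \<otimes>\<^bsub>P\<^esub> in1 y" by simp
qed (auto simp: amalg_in1_def intro!: class_closed)

lemma in2_hom: "in2 \<in> hom G2 P"
proof (rule homI)
  fix x y assume xy: "x \<in> carrier G2" "y \<in> carrier G2"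
  then have "in2 x \<otimes>\<^bsub>P\<^esub> in2 y = R `` {[Inr x, Inr y]}"
    using class_mult[of "[Inr x]" "[Inr y]"] by (simp add: amalg_in2_def InrI)
  also have "\<dots> = in2 (x \<otimes>\<^bsub>G2\<^esub> y)"
    unfolding amalg_in2_def using xy by (intro class_eq amalg_rel.mult2)
  finally show "in2 (x \<otimes>\<^bsub>G2\<^esub> y) = in2 x \<otimes>\<^bsub>P\<^esub> in2 y" by simp
qed (auto simp: amalg_in2_def intro!: class_closed)

lemma in1_i1_eq_in2_i2: "q \<in> carrier Q \<Longrightarrow> in1 (i1 q) = in2 (i2 q)"
  unfolding amalg_in1_def amalg_in2_def by (rule class_eq[OF amalg_rel.amalg])

lemma amalg_universal_exists:
  assumes H: "group H" and f1: "f1 \<in> hom G1 H" and f2: "f2 \<in> hom G2 H"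
    and comp: "\<And>q. q \<in> carrier Q \<Longrightarrow> f1 (i1 q) = f2 (i2 q)"
  shows "\<exists>f\<in>hom P H. (\<forall>x\<in>carrier G1. f (in1 x) = f1 x) \<and> (\<forall>y\<in>carrier G2. f (in2 y) = f2 y)"
proof -
  interpret H: group H by (rule H)
  define e where "e w = foldr (\<lambda>a z. case_sum f1 f2 a \<otimes>\<^bsub>H\<^esub> z) w \<one>\<^bsub>H\<^esub>" for w
  have e_Nil: "e [] = \<one>\<^bsub>H\<^esub>" and e_Cons: "e (a # w) = case_sum f1 f2 a \<otimes>\<^bsub>H\<^esub> e w" for a w
    by (simp_all add: e_def)
  have f1_closed: "f1 x \<in> carrier H" if "x \<in> carrier G1" for x
    using f1 that by (rule hom_in_carrier)
  have f2_closed: "f2 x \<in> carrier H" if "x \<in> carrier G2" for x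
    using f2 that by (rule hom_in_carrier)
  have e_closed: "w \<in> W \<Longrightarrow> e w \<in> carrier H" for w
    by (induction w) (auto simp: e_Nil e_Cons f1_closed f2_closed)
  have e_append: "u \<in> W \<Longrightarrow> v \<in> W \<Longrightarrow> e (u @ v) = e u \<otimes>\<^bsub>H\<^esub> e v" for u v
  proof (induction u)
    case (Cons a u)
    then have "case_sum f1 f2 a \<in> carrier H" "e u \<in> carrier H" "e v \<in> carrier H"
      by (auto simp: f1_closed f2_closed intro!: e_closed)
    with Cons show ?case by (simp add: e_Cons H.m_assoc)
  qed (simp add: e_Nil e_closed)
  have e_rel: "(u, v) \<in> R \<Longrightarrow> e u = e v" for u v
  proof (induction rule: amalg_rel.induct)
    case (append u v u' v')
    then show ?case using rel_words by (metis e_append)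
  next
    case one1
    then show ?case using hom_one[OF f1 G1.is_group H] by (simp add: e_Nil e_Cons)
  next
    case one2
    then show ?case using hom_one[OF f2 G2.is_group H] by (simp add: e_Nil e_Cons)
  next
    case (mult1 x y)
    then show ?case using f1 by (simp add: e_Nil e_Cons f1_closed hom_mult)
  next
    case (mult2 x y)
    then show ?case using f2 by (simp add: e_Nil e_Cons f2_closed hom_mult)
  next
    case (amalg q)
    then show ?case by (simp add: e_Nil e_Cons comp)
  qed auto
  define f where "f A = e (SOME u. u \<in> A)" for A
  have f_class: "f (R `` {u}) = e u" if "u \<in> W" for u
  proof -
    have "u \<in> R `` {u}" using that by (simp add: amalg_rel.refl)
    then have "(SOME v. v \<in> R `` {u}) \<in> R `` {u}" by (rule someI)
    then show ?thesis unfolding f_def using e_rel by (metis Image_singleton_iff)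
  qed
  have "f \<in> hom P H"
    by (rule homI; elim carrier_amalgE) (simp_all add: class_mult f_class e_closed e_append)
  moreover have "f (in1 x) = f1 x" if "x \<in> carrier G1" for x
    using that by (simp add: amalg_in1_def f_class e_Nil e_Cons f1_closed InlI)
  moreover have "f (in2 y) = f2 y" if "y \<in> carrier G2" for y
    using that by (simp add: amalg_in2_def f_class e_Nil e_Cons f2_closed InrI)
  ultimately show ?thesis by blast
qed

lemma amalg_universal_unique:
  assumes H: "group H" and f: "f \<in> hom P H" and g: "g \<in> hom P H"
    and eq1: "\<And>x. x \<in> carrier G1 \<Longrightarrow> f (in1 x) = g (in1 x)"
    and eq2: "\<And>y. y \<in> carrier G2 \<Longrightarrow> f (in2 y) = g (in2 y)"
    and A: "A \<in> carrier P"
  shows "f A = g A"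
proof -
  have "f (R `` {u}) = g (R `` {u})" if "u \<in> W" for u
    using that
  proof (induction u)
    case Nil
    then show ?case
      using hom_one[OF f group_amalg H] hom_one[OF g group_amalg H] by (simp add: one_amalg)
  next
    case (Cons a u)
    then have a: "[a] \<in> W" and u: "u \<in> W" by auto
    have "f (R `` {[a]}) = g (R `` {[a]})"
      using a eq1 eq2 by (auto simp: amalg_in1_def amalg_in2_def)
    moreover have "R `` {a # u} = R `` {[a]} \<otimes>\<^bsub>P\<^esub> R `` {u}"
      using class_mult[OF a u] by simp
    ultimately show ?case
      using Cons.IH u hom_mult[OF f class_closed[OF a] class_closed[OF u]]
        hom_mult[OF g class_closed[OF a] class_closed[OF u]] by simp
  qed
  then show ?thesis using A by (metis carrier_amalgE)
qed

end

end

theory Submission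
  imports Defs
begin

text \<open>
  An element \<open>g\<close> commensurates \<open>H\<close> iff \<open>H g H\<close> is a finite union of left cosets and a finite
  union of right cosets of \<open>H\<close>, that is, iff \<open>H g \<subseteq> F H\<close> and \<open>g H \<subseteq> H F'\<close> for some finite \<open>F\<close>
  and \<open>F'\<close>. In this form it is evident that commensurating elements are closed under products
  and preserved by arbitrary homomorphisms. The amalgamated product is generated by the images of
  the factors, so no normal form (not even injectivity of the factors) is needed.
\<close>

section \<open>Finite index in terms of finite covers by cosets\<close>

text \<open>Equal labels force equal cosets \<open>B #> a\<close>, so there are at most as many
  cosets as values of \<open>\<phi>\<close>. The label will be a coset representative picked from a
  finite cover.\<close>

lemma (in group) finite_indexI:
  assumes "subgroup B G" and "A \<subseteq> carrier G" and "finite (\<phi> ` A)"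
    and "\<And>a a'. a \<in> A \<Longrightarrow> a' \<in> A \<Longrightarrow> \<phi> a = \<phi> a' \<Longrightarrow> a \<otimes> inv a' \<in> B"
  shows "finite_index G A B"
proof -
  have eq: "B #> a = B #> a'" if "a \<in> A" "a' \<in> A" "\<phi> a = \<phi> a'" for a a'
  proof -
    have G: "a \<in> carrier G" "a' \<in> carrier G" using that assms(2) by auto
    have "a \<in> B #> a'"
      using assms(1) is_group G(2,1) assms(4)[OF that] by (rule subgroup.rcos_module_rev)
    then show ?thesis
      using G assms(1) by (metis repr_independence)
  qed
  \<comment> \<open>\<open>inv_into A \<phi> z\<close> is a chosen element with label
    \<open>z\<close>; its coset is the coset of every element with that label.\<close>
  have "(\<lambda>a. B #> a) ` A \<subseteq> (\<lambda>z. B #> inv_into A \<phi> z) ` (\<phi> ` A)"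
  proof
    fix C assume "C \<in> (\<lambda>a. B #> a) ` A"
    then obtain a where a: "a \<in> A" "C = B #> a" by blast
    have "inv_into A \<phi> (\<phi> a) \<in> A" "\<phi> (inv_into A \<phi> (\<phi> a)) = \<phi> a"
      using a by (auto intro: inv_into_into f_inv_into_f)
    then have "C = B #> inv_into A \<phi> (\<phi> a)"
      using a eq by metis
    then show "C \<in> (\<lambda>z. B #> inv_into A \<phi> z) ` (\<phi> ` A)"
      using a by blast
  qed
  then have "finite ((\<lambda>a. B #> a) ` A)"
    using assms(3) finite_subset by blast
  \<comment> \<open>Replacing the carrier restricts the representatives to \<open>A\<close> but
    keeps the multiplication, hence each single coset.\<close>
  moreover have "rcosets\<^bsub>G\<lparr>carrier := A\<rparr>\<^esub> B = (\<lambda>a. B #> a) ` A"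
    by (auto simp: RCOSETS_def r_coset_def)
  ultimately show ?thesis
    by (simp add: finite_index_def)
qed

text \<open>Take finitely many representatives that realize all cosets. They cover \<open>A\<close>
  because each \<open>a\<close> lies in its own coset, as \<open>B\<close> contains the
  identity.\<close>

lemma (in group) finite_indexE:
  assumes "finite_index G A B" and "subgroup B G" and "A \<subseteq> carrier G"
  obtains F where "finite F" "F \<subseteq> A" "A \<subseteq> B <#> F"
proof -
  have "rcosets\<^bsub>G\<lparr>carrier := A\<rparr>\<^esub> B = (\<lambda>a. B #> a) ` A"
    by (auto simp: RCOSETS_def r_coset_def)
  then have "finite ((\<lambda>a. B #> a) ` A)"
    using assms(1) by (simp add: finite_index_def)
  then obtain F where F: "F \<subseteq> A" "finite F" "(\<lambda>a. B #> a) ` A = (\<lambda>a. B #> a) ` F"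
    by (meson finite_subset_image subset_refl)
  have "A \<subseteq> B <#> F"
  proof
    fix a assume a: "a \<in> A"
    then obtain f where f: "f \<in> F" "B #> a = B #> f" using F by blast
    have "a \<in> B #> a"
      using a assms by (auto intro: rcos_self)
    then have "a \<in> B #> f"
      using f by simp
    then show "a \<in> B <#> F"
      using f(1) by (auto simp: r_coset_def set_mult_def)
  qed
  then show ?thesis using F that by blast
qed

section \<open>Conjugates and the description of commensuration by covers\<close>

lemma (in group) inv_cancel:
  assumes "x \<in> carrier G" and "y \<in> carrier G"
  shows "inv x \<otimes> (x \<otimes> y) = y" and "x \<otimes> (inv x \<otimes> y) = y"
  using assms by (simp_all flip: m_assoc)

lemma (in group) mem_conjugate_iff:
  assumes "g \<in> carrier G" and "H \<subseteq> carrier G"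
  shows "x \<in> conjugate G g H \<longleftrightarrow> (\<exists>h\<in>H. x = g \<otimes> h \<otimes> inv g)"
  by (auto simp: conjugate_def l_coset_def r_coset_def)

lemma (in group) subgroup_conjugate:
  assumes "g \<in> carrier G" and "subgroup H G"
  shows "subgroup (conjugate G g H) G"
proof -
  have H: "H \<subseteq> carrier G" using assms(2) by (rule subgroup.subset)
  have "g \<otimes> h \<otimes> inv g \<otimes> (g \<otimes> k \<otimes> inv g) = g \<otimes> (h \<otimes> k) \<otimes> inv g" if "h \<in> H" "k \<in> H" for h k
    using that H assms(1) by (simp add: m_assoc inv_cancel subsetD)
  moreover have "inv (g \<otimes> h \<otimes> inv g) = g \<otimes> inv h \<otimes> inv g" if "h \<in> H" for h
    using that H assms(1) by (simp add: inv_mult_group m_assoc subsetD)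
  moreover have "conjugate G g H \<noteq> {}"
    using subgroup.one_closed[OF assms(2)] mem_conjugate_iff[OF assms(1) H] by blast
  ultimately show ?thesis
    using assms H subgroup.one_closed[OF assms(2)] subgroup.m_closed[OF assms(2)]
      subgroup.m_inv_closed[OF assms(2)]
    by (intro subgroupI) (auto simp: mem_conjugate_iff subset_iff)
qed

text \<open>Let \<open>K\<close> be the conjugate of \<open>H\<close> by \<open>g\<close>. For
  \<open>a\<close>, \<open>b\<close> in \<open>H\<close>, \<open>a \<otimes> inv b\<close> lies in
  \<open>K\<close> exactly when \<open>inv a \<otimes> g\<close> and
  \<open>inv b \<otimes> g\<close> lie in the same left coset of \<open>H\<close>. For
  \<open>a\<close>, \<open>b\<close> in \<open>K\<close>, \<open>a \<otimes> inv b\<close> lies in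
  \<open>H\<close> exactly when \<open>a \<otimes> g\<close> and \<open>b \<otimes> g\<close> lie in
  the same right coset of \<open>H\<close>. So the two indices count the left cosets meeting
  \<open>H #> g\<close> and the right cosets meeting \<open>g <# H\<close>.\<close>

lemma (in group) mem_Comm_iff:
  assumes g: "g \<in> carrier G" and H: "subgroup H G"
  shows "g \<in> Comm H G \<longleftrightarrow>
    (\<exists>F F'. finite F \<and> finite F' \<and> F \<subseteq> carrier G \<and> F' \<subseteq> carrier G \<and>
      H #> g \<subseteq> F <#> H \<and> g <# H \<subseteq> H <#> F')"
proof
  have HG: "H \<subseteq> carrier G" using H by (rule subgroup.subset)
  note [simp] = subsetD[OF HG] subgroup.m_inv_closed[OF H] subgroup.m_closed[OF H] g
  let ?K = "conjugate G g H"
  have K: "subgroup ?K G" using g H by (rule subgroup_conjugate)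
  have KG: "?K \<subseteq> carrier G" using K by (rule subgroup.subset)
  have KH: "subgroup (?K \<inter> H) G" using K H by (rule subgroups_Inter_pair)
  note mem_K = mem_conjugate_iff[OF g HG]
  {
    assume "g \<in> Comm H G"
    then have fi: "finite_index G H (?K \<inter> H)" "finite_index G ?K (?K \<inter> H)"
      by (auto simp: Comm_def)
    obtain F where F: "finite F" "F \<subseteq> H" "H \<subseteq> (?K \<inter> H) <#> F"
      using fi(1) KH HG by (rule finite_indexE)
    obtain F' where F': "finite F'" "F' \<subseteq> ?K" "?K \<subseteq> (?K \<inter> H) <#> F'"
      using fi(2) KH KG by (rule finite_indexE)
    \<comment> \<open>The cover is applied to \<open>inv h\<close>: inverting
      \<open>inv h = g \<otimes> l \<otimes> inv g \<otimes> f\<close> moves the representative to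
      the left and gives \<open>h \<otimes> g = (inv f \<otimes> g) \<otimes> inv l\<close>.\<close>
    have "H #> g \<subseteq> (\<lambda>f. inv f \<otimes> g) ` F <#> H"
    proof
      fix x assume "x \<in> H #> g"
      then obtain h where h: "h \<in> H" "x = h \<otimes> g" by (auto simp: r_coset_def)
      then have "inv h \<in> (?K \<inter> H) <#> F" using F by auto
      then obtain k f where kf: "k \<in> ?K" "f \<in> F" "inv h = k \<otimes> f" by (auto simp: set_mult_def)
      then obtain l where l: "l \<in> H" "k = g \<otimes> l \<otimes> inv g" by (auto simp: mem_K)
      have fG: "f \<in> carrier G" using kf F by auto
      have "h = inv (g \<otimes> l \<otimes> inv g \<otimes> f)" using kf l h by (metis inv_inv subsetD HG)
      then have "x = (inv f \<otimes> g) \<otimes> inv l"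
        using l fG h(2) by (simp add: inv_mult_group m_assoc)
      then show "x \<in> (\<lambda>f. inv f \<otimes> g) ` F <#> H"
        unfolding set_mult_def using kf(2) subgroup.m_inv_closed[OF H l(1)] by blast
    qed
    \<comment> \<open>Since \<open>g \<otimes> h\<close> is the conjugate of \<open>h\<close> times
      \<open>g\<close>, the cover of \<open>?K\<close> only has to be multiplied by \<open>g\<close>
      on the right.\<close>
    moreover have "g <# H \<subseteq> H <#> (\<lambda>f. f \<otimes> g) ` F'"
    proof
      fix x assume "x \<in> g <# H"
      then obtain h where h: "h \<in> H" "x = g \<otimes> h" by (auto simp: l_coset_def)
      then have "g \<otimes> h \<otimes> inv g \<in> (?K \<inter> H) <#> F'" using F' mem_K by blast
      then obtain k f where kf: "k \<in> H" "f \<in> F'" "g \<otimes> h \<otimes> inv g = k \<otimes> f"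
        by (auto simp: set_mult_def)
      have fG: "f \<in> carrier G" using kf F' KG by auto
      have "x = g \<otimes> h \<otimes> inv g \<otimes> g" using h by (simp add: m_assoc)
      also have "\<dots> = k \<otimes> (f \<otimes> g)" using kf fG by (simp add: m_assoc)
      finally show "x \<in> H <#> (\<lambda>f. f \<otimes> g) ` F'"
        using kf by (auto simp: set_mult_def)
    qed
    moreover have "(\<lambda>f. inv f \<otimes> g) ` F \<subseteq> carrier G" "(\<lambda>f. f \<otimes> g) ` F' \<subseteq> carrier G"
      using F F' KG by auto
    ultimately show "\<exists>F F'. finite F \<and> finite F' \<and> F \<subseteq> carrier G \<and> F' \<subseteq> carrier G \<and>
      H #> g \<subseteq> F <#> H \<and> g <# H \<subseteq> H <#> F'"
      using F(1) F'(1) by blast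
  next
    assume "\<exists>F F'. finite F \<and> finite F' \<and> F \<subseteq> carrier G \<and> F' \<subseteq> carrier G \<and>
      H #> g \<subseteq> F <#> H \<and> g <# H \<subseteq> H <#> F'"
    then obtain F F' where F: "finite F" "F \<subseteq> carrier G" "H #> g \<subseteq> F <#> H"
      and F': "finite F'" "F' \<subseteq> carrier G" "g <# H \<subseteq> H <#> F'" by blast
    \<comment> \<open>The label of \<open>h\<close> represents the left coset of
      \<open>inv h \<otimes> g\<close>; the inverse is there because the index is counted by right
      cosets while \<open>F <#> H\<close> consists of left cosets.\<close>
    have "\<forall>h\<in>H. \<exists>f\<in>F. \<exists>u\<in>H. inv h \<otimes> g = f \<otimes> u"
    proof
      fix h assume "h \<in> H"
      then have "inv h \<otimes> g \<in> H #> g" by (auto simp: r_coset_def)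
      then show "\<exists>f\<in>F. \<exists>u\<in>H. inv h \<otimes> g = f \<otimes> u" using F(3) unfolding set_mult_def by blast
    qed
    then obtain \<phi> where \<phi>: "\<forall>h\<in>H. \<phi> h \<in> F \<and> (\<exists>u\<in>H. inv h \<otimes> g = \<phi> h \<otimes> u)" by metis
    have 1: "finite_index G H (?K \<inter> H)"
    proof (rule finite_indexI[OF KH HG, where \<phi> = \<phi>])
      show "finite (\<phi> ` H)" using \<phi> F(1) by (meson finite_subset image_subsetI)
    next
      fix a b assume ab: "a \<in> H" "b \<in> H" "\<phi> a = \<phi> b"
      then obtain u v where uv: "u \<in> H" "v \<in> H" "inv a \<otimes> g = \<phi> a \<otimes> u" "inv b \<otimes> g = \<phi> a \<otimes> v"
        using \<phi> by metis
      have pG: "\<phi> a \<in> carrier G" using \<phi> ab F by blast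
      \<comment> \<open>Solve both equations for \<open>a\<close> and \<open>inv b\<close>: the
        common label \<open>\<phi> a\<close> then cancels in \<open>a \<otimes> inv b\<close> and
        leaves a conjugate of \<open>inv u \<otimes> v\<close>.\<close>
      have "a = inv (\<phi> a \<otimes> u \<otimes> inv g)"
        using ab(1) by (simp flip: uv(3) add: m_assoc)
      moreover have "inv b = \<phi> a \<otimes> v \<otimes> inv g"
        using ab(2) by (simp flip: uv(4) add: m_assoc)
      ultimately have "a \<otimes> inv b = inv (\<phi> a \<otimes> u \<otimes> inv g) \<otimes> (\<phi> a \<otimes> v \<otimes> inv g)"
        by (rule arg_cong2)
      also have "\<dots> = g \<otimes> (inv u \<otimes> v) \<otimes> inv g"
        using uv(1,2) pG by (simp add: inv_mult_group m_assoc inv_cancel)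
      finally have "a \<otimes> inv b = g \<otimes> (inv u \<otimes> v) \<otimes> inv g" .
      moreover have "inv u \<otimes> v \<in> H" using uv by simp
      ultimately have "a \<otimes> inv b \<in> ?K" using mem_K by blast
      then show "a \<otimes> inv b \<in> ?K \<inter> H" using ab by simp
    qed
    \<comment> \<open>Right multiplication by \<open>g\<close> takes \<open>?K\<close> into
      \<open>g <# H\<close>, which is already covered by right cosets, so here the label is taken
      without inverting.\<close>
    have "\<forall>x\<in>?K. \<exists>f\<in>F'. \<exists>k\<in>H. x \<otimes> g = k \<otimes> f"
    proof
      fix x assume "x \<in> ?K"
      then obtain h where h: "h \<in> H" "x = g \<otimes> h \<otimes> inv g" using mem_K by auto
      then have "x \<otimes> g \<in> g <# H" by (auto simp: l_coset_def m_assoc)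
      then show "\<exists>f\<in>F'. \<exists>k\<in>H. x \<otimes> g = k \<otimes> f" using F'(3) unfolding set_mult_def by blast
    qed
    then obtain \<psi> where \<psi>: "\<forall>x\<in>?K. \<psi> x \<in> F' \<and> (\<exists>k\<in>H. x \<otimes> g = k \<otimes> \<psi> x)" by metis
    have 2: "finite_index G ?K (?K \<inter> H)"
    proof (rule finite_indexI[OF KH KG, where \<phi> = \<psi>])
      show "finite (\<psi> ` ?K)" using \<psi> F'(1) by (meson finite_subset image_subsetI)
    next
      fix a b assume ab: "a \<in> ?K" "b \<in> ?K" "\<psi> a = \<psi> b"
      then obtain u v where uv: "u \<in> H" "v \<in> H" "a \<otimes> g = u \<otimes> \<psi> a" "b \<otimes> g = v \<otimes> \<psi> a"
        using \<psi> by metis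
      have pG: "\<psi> a \<in> carrier G" using \<psi> ab F' by blast
      have abG: "a \<in> carrier G" "b \<in> carrier G" using ab KG by auto
      \<comment> \<open>Multiplying both elements by \<open>g\<close> on the right does not change
        the quotient, and then the common label \<open>\<psi> a\<close> cancels.\<close>
      have "a \<otimes> inv b = (a \<otimes> g) \<otimes> inv (b \<otimes> g)"
        using abG by (simp add: inv_mult_group m_assoc inv_cancel)
      also have "\<dots> = u \<otimes> inv v"
        unfolding uv(3,4) using uv(1,2) pG
        by (simp add: inv_mult_group m_assoc inv_cancel)
      finally have "a \<otimes> inv b \<in> H" using uv(1,2) by simp
      moreover have "a \<otimes> inv b \<in> ?K"
        using ab subgroup.m_closed[OF K] subgroup.m_inv_closed[OF K] by blast
      ultimately show "a \<otimes> inv b \<in> ?K \<inter> H" by blast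
    qed
    show "g \<in> Comm H G" using 1 2 by (simp add: Comm_def)
  }
qed

section \<open>Closure of commensurators under products and homomorphic images\<close>

lemma (in group) one_mem_Comm:
  assumes "subgroup H G"
  shows "\<one> \<in> Comm H G"
proof -
  have "H \<subseteq> carrier G" using assms by (rule subgroup.subset)
  then have "H #> \<one> \<subseteq> {\<one>} <#> H \<and> \<one> <# H \<subseteq> H <#> {\<one>}"
    by (force simp: r_coset_def l_coset_def set_mult_def)
  then show ?thesis
    using mem_Comm_iff[OF one_closed assms]
    by (metis empty_subsetI finite.emptyI finite_insert insert_subset one_closed)
qed

text \<open>Covers multiply: \<open>H x y \<subseteq> E H y \<subseteq> E F H\<close> and
  \<open>x y H \<subseteq> x H F' \<subseteq> H E' F'\<close>, where the products of the finite sets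
  are finite again.\<close>

lemma (in group) mult_mem_Comm:
  assumes H: "subgroup H G" and x: "x \<in> Comm H G" and y: "y \<in> Comm H G"
  shows "x \<otimes> y \<in> Comm H G"
proof -
  have HG: "H \<subseteq> carrier G" using H by (rule subgroup.subset)
  have xyG: "x \<in> carrier G" "y \<in> carrier G" using x y by (auto simp: Comm_def)
  obtain E E' where E: "finite E" "finite E'" "E \<subseteq> carrier G" "E' \<subseteq> carrier G"
      "H #> x \<subseteq> E <#> H" "x <# H \<subseteq> H <#> E'"
    using x mem_Comm_iff[OF xyG(1) H] by auto
  obtain F F' where F: "finite F" "finite F'" "F \<subseteq> carrier G" "F' \<subseteq> carrier G"
      "H #> y \<subseteq> F <#> H" "y <# H \<subseteq> H <#> F'"
    using y mem_Comm_iff[OF xyG(2) H] by auto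
  have fin: "finite (A <#> B)" if "finite A" "finite B" for A B
    using that by (simp add: set_mult_def)
  have "H #> (x \<otimes> y) = (H #> x) #> y"
    using HG xyG by (simp add: coset_mult_assoc)
  also have "\<dots> \<subseteq> (E <#> H) #> y"
    using E(5) by (auto simp: r_coset_def)
  also have "\<dots> = E <#> (H #> y)"
    using E(3) HG xyG by (simp add: setmult_rcos_assoc)
  also have "\<dots> \<subseteq> E <#> (F <#> H)"
    using F(5) by (rule mono_set_mult[OF subset_refl])
  also have "\<dots> = (E <#> F) <#> H"
    using E(3) F(3) HG by (simp add: set_mult_assoc)
  finally have 1: "H #> (x \<otimes> y) \<subseteq> (E <#> F) <#> H" .
  have "(x \<otimes> y) <# H = x <# (y <# H)"
    using HG xyG by (simp add: lcos_m_assoc)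
  also have "\<dots> \<subseteq> x <# (H <#> F')"
    using F(6) by (auto simp: l_coset_def)
  also have "\<dots> = (x <# H) <#> F'"
    using F(4) HG xyG by (simp add: l_coset_eq_set_mult set_mult_assoc)
  also have "\<dots> \<subseteq> (H <#> E') <#> F'"
    using E(6) by (rule mono_set_mult[OF _ subset_refl])
  also have "\<dots> = H <#> (E' <#> F')"
    using E(4) F(4) HG by (simp add: set_mult_assoc)
  finally have 2: "(x \<otimes> y) <# H \<subseteq> H <#> (E' <#> F')" .
  show ?thesis
    using 1 2 fin[OF E(1) F(1)] fin[OF E(2) F(2)] set_mult_closed[OF E(3) F(3)]
      set_mult_closed[OF E(4) F(4)] mem_Comm_iff[OF m_closed[OF xyG] H] by blast
qed

text \<open>A homomorphism maps products of sets to products of sets, so the images of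
  \<open>F\<close> and \<open>F'\<close> serve as covers. In this form no intersection has to be
  compared with its image.\<close>

lemma (in group_hom) image_mem_Comm:
  assumes K: "subgroup K G" and x: "x \<in> Comm K G"
  shows "h x \<in> Comm (h ` K) H"
proof -
  have KG: "K \<subseteq> carrier G" using K by (rule subgroup.subset)
  have xG: "x \<in> carrier G" using x by (simp add: Comm_def)
  obtain F F' where F: "finite F" "finite F'" "F \<subseteq> carrier G" "F' \<subseteq> carrier G"
      "K #> x \<subseteq> F <#> K" "x <# K \<subseteq> K <#> F'"
    using x G.mem_Comm_iff[OF xG K] by auto
  have "h ` K #>\<^bsub>H\<^esub> h x = h ` (K #> x)"
    using KG xG by (force simp: r_coset_def)
  also have "\<dots> \<subseteq> h ` (F <#> K)"
    using F(5) by (rule image_mono)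
  also have "\<dots> = h ` F <#>\<^bsub>H\<^esub> h ` K"
    using F(3) KG homh by (simp add: set_mult_hom)
  finally have 1: "h ` K #>\<^bsub>H\<^esub> h x \<subseteq> h ` F <#>\<^bsub>H\<^esub> h ` K" .
  have "h x <#\<^bsub>H\<^esub> h ` K = h ` (x <#\<^bsub>G\<^esub> K)"
    using KG xG by (force simp: l_coset_def)
  also have "\<dots> \<subseteq> h ` (K <#> F')"
    using F(6) by (rule image_mono)
  also have "\<dots> = h ` K <#>\<^bsub>H\<^esub> h ` F'"
    using F(4) KG homh by (simp add: set_mult_hom)
  finally have 2: "h x <#\<^bsub>H\<^esub> h ` K \<subseteq> h ` K <#>\<^bsub>H\<^esub> h ` F'" .
  have "h ` F \<subseteq> carrier H" "h ` F' \<subseteq> carrier H" using F(3,4) by auto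
  then show ?thesis
    using 1 2 F(1,2) H.mem_Comm_iff[OF hom_closed[OF xG] subgroup_img_is_subgroup[OF K]]
    by blast
qed

section \<open>Quasi-normality in the amalgamated product\<close>

theorem lemma15:
  fixes G1 :: "('a, 'm) monoid_scheme" and G2 :: "('b, 'n) monoid_scheme"
    and Q :: "('q, 'k) monoid_scheme" and i1 :: "'q \<Rightarrow> 'a" and i2 :: "'q \<Rightarrow> 'b"
  assumes "group G1" and "group G2" and "group Q"
    and "i1 \<in> mon Q G1" and "i2 \<in> mon Q G2"
    and "quasi_normal (i1 ` carrier Q) G1"
    and "quasi_normal (i2 ` carrier Q) G2"
  shows "quasi_normal ((amalg_in1 G1 G2 Q i1 i2 \<circ> i1) ` carrier Q) (amalg G1 G2 Q i1 i2)"
proof -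
  interpret amalgamation G1 G2 Q i1 i2
    using assms by (intro amalgamation.intro amalgamation_axioms.intro)
  interpret P: group P by (rule group_amalg)
  interpret in1: group_hom G1 P in1 by unfold_locales (rule in1_hom)
  interpret in2: group_hom G2 P in2 by unfold_locales (rule in2_hom)
  let ?H = "(in1 \<circ> i1) ` carrier Q"
  \<comment> \<open>The identification of \<open>i1 q\<close> with \<open>i2 q\<close> makes
    \<open>?H\<close> the image of a quasi-normal subgroup from either factor, so both factors land
    in the same commensurator.\<close>
  have H1: "?H = in1 ` i1 ` carrier Q" by (simp add: image_comp)
  have H2: "?H = in2 ` i2 ` carrier Q" by (force simp: in1_i1_eq_in2_i2)
  have s1: "subgroup (i1 ` carrier Q) G1" and c1: "Comm (i1 ` carrier Q) G1 = carrier G1"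
    using assms(6) by (auto simp: quasi_normal_def)
  have s2: "subgroup (i2 ` carrier Q) G2" and c2: "Comm (i2 ` carrier Q) G2 = carrier G2"
    using assms(7) by (auto simp: quasi_normal_def)
  have sH: "subgroup ?H P"
    unfolding H1 using s1 by (rule in1.subgroup_img_is_subgroup)
  have in1_Comm: "in1 x \<in> Comm ?H P" if "x \<in> carrier G1" for x
    unfolding H1 using s1 that by (intro in1.image_mem_Comm) (simp_all add: c1)
  have in2_Comm: "in2 y \<in> Comm ?H P" if "y \<in> carrier G2" for y
    unfolding H2 using s2 that by (intro in2.image_mem_Comm) (simp_all add: c2)
  \<comment> \<open>Induction on words: a class is the product of the classes of its letters, and
    each letter comes from one of the factors.\<close>
  have "R `` {u} \<in> Comm ?H P" if "u \<in> W" for u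
    using that
  proof (induction u)
    case Nil
    then show ?case using P.one_mem_Comm[OF sH] by (simp add: one_amalg)
  next
    case (Cons a u)
    then have a: "[a] \<in> W" and u: "u \<in> W" by auto
    have "R `` {[a]} \<in> Comm ?H P"
      using a in1_Comm in2_Comm by (auto simp: amalg_in1_def amalg_in2_def)
    then have "R `` {[a]} \<otimes>\<^bsub>P\<^esub> R `` {u} \<in> Comm ?H P"
      using Cons.IH u P.mult_mem_Comm[OF sH] by blast
    then show ?case
      using class_mult[OF a u] by simp
  qed
  then have "carrier P \<subseteq> Comm ?H P"
    by (auto elim!: carrier_amalgE)
  then show ?thesis
    using sH by (auto simp: quasi_normal_def Comm_def)
qed

end
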